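(* Let $X^r=\mathrm{span}\{\varphi_i\}_{i=1}^r\subset\mathcal H$ be the span of the first $r$ POD modes constructed with difference quotients, let $P_r:\mathcal H\to\mathcal H$, $P_r v=\sum_{i=1}^r (v,\varphi_i)_{\mathcal H}\varphi_i$, be the $\mathcal H$-orthogonal projection onto $X^r$, and let $s$ be the number of positive POD eigenvalues of the collection $U^{\mathrm{DQ}}$ (snapshots together with difference quotients); here $1\le r\le s$. If $W$ is a real Hilbert space with $U^{\mathrm{DQ}}\subset W$ and $R_r:W\to W$ is a bounded linear projection onto $X^r$, then $$\max_{0\le k\le N}\|u^k-P_ru^k\|_{\mathcal H}^2\le C\sum_{i=r+1}^s\lambda_i^{\mathrm{DQ}},$$ $$\max_{0\le k\le N}\|u^k-P_ru^k\|_{W}^2\le C\sum_{i=r+1}^s\lambda_i^{\mathrm{DQ}}\|\varphi_i\|_W^2,$$ $$\max_{0\le k\le N}\|u^k-R_ru^k\|_{W}^2\le C\sum_{i=r+1}^s\lambda_i^{\mathrm{DQ}}\|\varphi_i-R_r\varphi_i\|_W^2,$$ where $C=6\max\{1,T^2\}$.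
   Context: $\mathcal H$ is a real Hilbert space, $T>0$, $N\ge 1$ an integer, $\Delta t=T/N$, $t_n=n\Delta t$. The snapshots are $u^n=u(t_n)$, $n=0,\dots,N$, for some $u\in C([0,T];\mathcal H)$. Difference quotients: $\partial u^n=(u^n-u^{n-1})/\Delta t$, $n=1,\dots,N$. The collection $U^{\mathrm{DQ}}=\{v^n\}_{n=0}^{2N}$ is defined by $v^n=u^n$ for $0\le n\le N$ and $v^{N+n}=\partial u^n$ for $1\le n\le N$. POD with difference quotients: let $K$ be the $(2N+1)\times(2N+1)$ symmetric positive semidefinite matrix $K_{mn}=\frac1{2N+1}(v^m,v^n)_{\mathcal H}$, $m,n=0,\dots,2N$, with eigenvalues $\lambda_1^{\mathrm{DQ}}\ge\lambda_2^{\mathrm{DQ}}\ge\cdots\ge 0$ (counted with multiplicity) and corresponding orthonormal eigenvectors $\mathbf z_i$. Let $s$ be the number of positive eigenvalues. The POD modes are $\varphi_i=(\lambda_i^{\mathrm{DQ}})^{-1/2}(2N+1)^{-1/2}\sum_{m=0}^{2N}(\mathbf z_i)^m v^m$, $i=1,\dots,s$, where $(\mathbf z_i)^m$ is the $m$th entry of $\mathbf z_i$; they are orthonormal in $\mathcal H$. $\mathcal H$ and $W$ are understood as linear subspaces of a common real vector space, so that linear combinations of the snapshots mean the same in both spaces. A bounded linear operator $\Pi:Z\to Z$ is a projection onto $Z^r\subset Z$ if $\Pi^2=\Pi$ and the range of $\Pi$ equals $Z^r$. An empty sum is $0$. *)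

theory Defs
  imports Complex_Main "HOL-Analysis.Inner_Product" "Jordan_Normal_Form.Char_Poly"
begin

text \<open>
  A real Hilbert space is a type of sort \<open>{real_inner, complete_space}\<close>. Two Hilbert spaces
  that are linear subspaces of a common real vector space are types \<open>'h\<close>, \<open>'w\<close> with injective
  linear inclusions \<open>jH\<close>, \<open>jW\<close> into a type \<open>'v\<close> of sort \<open>real_vector\<close>; no relation between
  the two norms is required.
\<close>

definition snapshot :: "(real \<Rightarrow> 'h) \<Rightarrow> real \<Rightarrow> nat \<Rightarrow> nat \<Rightarrow> 'h" where
  "snapshot u T N n = u (real n * (T / real N))"

definition diff_quot :: "(real \<Rightarrow> 'h::real_vector) \<Rightarrow> real \<Rightarrow> nat \<Rightarrow> nat \<Rightarrow> 'h" where
  "diff_quot u T N n = (snapshot u T N n - snapshot u T N (n - 1)) /\<^sub>R (T / real N)"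

definition dq_data :: "(real \<Rightarrow> 'h::real_vector) \<Rightarrow> real \<Rightarrow> nat \<Rightarrow> nat \<Rightarrow> 'h" where
  "dq_data u T N n = (if n \<le> N then snapshot u T N n else diff_quot u T N (n - N))"

definition pod_matrix :: "(real \<Rightarrow> 'h::real_inner) \<Rightarrow> real \<Rightarrow> nat \<Rightarrow> real mat" where
  "pod_matrix u T N =
     mat (2 * N + 1) (2 * N + 1)
       (\<lambda>(m, n). inner (dq_data u T N m) (dq_data u T N n) / real (2 * N + 1))"

text \<open>
  Eigenvalues and eigenvectors are indexed from 1 to the dimension, entries of vectors from 0.
  The characteristic polynomial says that the eigenvalues are listed with multiplicity (for
  an orthonormal family of this length it is a consequence of the other conditions).
\<close>

definition ordered_eigensystem :: "real mat \<Rightarrow> (nat \<Rightarrow> real) \<Rightarrow> (nat \<Rightarrow> real vec) \<Rightarrow> bool" where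
  "ordered_eigensystem A lam z \<longleftrightarrow>
     char_poly A = (\<Prod>i=1..dim_row A. [:- lam i, 1:]) \<and>
     (\<forall>i j. 1 \<le> i \<and> i \<le> j \<and> j \<le> dim_row A \<longrightarrow> lam j \<le> lam i) \<and>
     (\<forall>i\<in>{1..dim_row A}. eigenvector A (z i) (lam i)) \<and>
     (\<forall>i\<in>{1..dim_row A}. \<forall>j\<in>{1..dim_row A}.
        scalar_prod (z i) (z j) = (if i = j then 1 else 0))"

definition num_positive :: "nat \<Rightarrow> (nat \<Rightarrow> real) \<Rightarrow> nat" where
  "num_positive N lam = card {i \<in> {1..2 * N + 1}. 0 < lam i}"

text \<open>Meaningful only for indices with \<open>lam i > 0\<close>.\<close>

definition pod_mode ::
  "(real \<Rightarrow> 'h::real_vector) \<Rightarrow> real \<Rightarrow> nat \<Rightarrow> (nat \<Rightarrow> real) \<Rightarrow> (nat \<Rightarrow> real vec) \<Rightarrow> nat \<Rightarrow> 'h" where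
  "pod_mode u T N lam z i =
     (1 / sqrt (lam i) * (1 / sqrt (real (2 * N + 1)))) *\<^sub>R
       (\<Sum>m=0..2 * N. vec_index (z i) m *\<^sub>R dq_data u T N m)"

definition pod_space :: "(nat \<Rightarrow> 'h::real_vector) \<Rightarrow> nat \<Rightarrow> 'h set" where
  "pod_space \<phi> r = real_vector.span (\<phi> ` {1..r})"

definition pod_proj :: "(nat \<Rightarrow> 'h::real_inner) \<Rightarrow> nat \<Rightarrow> 'h \<Rightarrow> 'h" where
  "pod_proj \<phi> r x = (\<Sum>i=1..r. inner x (\<phi> i) *\<^sub>R \<phi> i)"

definition bounded_projection_onto :: "('w::real_normed_vector \<Rightarrow> 'w) \<Rightarrow> 'w set \<Rightarrow> bool" where
  "bounded_projection_onto R Z \<longleftrightarrow> bounded_linear R \<and> R \<circ> R = R \<and> range R = Z"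

text \<open>
  The element \<open>x\<close> of \<open>'h\<close> regarded as an element of \<open>'w\<close>. Meaningful only if \<open>x\<close> lies in both
  spaces, that is, if \<open>jH x \<in> range jW\<close>.
\<close>

definition as_elem :: "('h \<Rightarrow> 'v) \<Rightarrow> ('w \<Rightarrow> 'v) \<Rightarrow> 'h \<Rightarrow> 'w" where
  "as_elem jH jW x = inv_into UNIV jW (jH x)"

end

theory Submission
  imports Defs "HOL-Analysis.Convex"
begin

text \<open>
  Since the eigenvectors form an orthonormal basis of the coefficient space, Parseval's identity
  gives \<open>\<Sum>m. \<parallel>L v\<^sup>m\<parallel>\<^sup>2 = (2N + 1) \<Sum>i. \<lambda>\<^sub>i \<parallel>L \<phi>\<^sub>i\<parallel>\<^sup>2\<close> for every linear map \<open>L\<close> into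
  any inner product space. Telescoping and the Cauchy-Schwarz inequality bound each
  \<open>\<parallel>L u\<^sup>k\<parallel>\<^sup>2\<close> by the left-hand side. The three estimates are the cases \<open>L = I - P\<^sub>r\<close>, the
  same map followed by the passage to \<open>W\<close>, and the passage to \<open>W\<close> followed by \<open>I - R\<^sub>r\<close>; each
  kills \<open>\<phi>\<^sub>1, \<dots>, \<phi>\<^sub>r\<close>.
\<close>

section \<open>Orthonormal eigenvectors and Gram matrices\<close>

text \<open>An orthonormal family of full length forms the rows of a square matrix \<open>A\<close>
  with A A^T = 1. A right inverse of a square matrix is also a left inverse, so the columns are
  orthonormal too; this is the relation \<open>complete\<close>, which collapses the expanded
  squares. The \<open>y m\<close> are vectors so that images of the data in any inner product space
  are covered.\<close>

lemma orthonormal_parseval: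
  fixes z :: "nat \<Rightarrow> real vec" and y :: "nat \<Rightarrow> 'a::real_inner"
  assumes carr: "\<And>i. i \<in> {1..n} \<Longrightarrow> z i \<in> carrier_vec n"
    and orth: "\<And>i j. i \<in> {1..n} \<Longrightarrow> j \<in> {1..n} \<Longrightarrow>
      scalar_prod (z i) (z j) = (if i = j then 1 else 0)"
  shows "(\<Sum>i=1..n. (norm (\<Sum>m<n. vec_index (z i) m *\<^sub>R y m))\<^sup>2) = (\<Sum>m<n. (norm (y m))\<^sup>2)"
proof -
  define A where "A = mat n n (\<lambda>(i, m). vec_index (z (Suc i)) m)"
  have A: "A \<in> carrier_mat n n"
    by (simp add: A_def)
  have row: "row A i = z (Suc i)" if "i < n" for i
    using that carr[of "Suc i"] by (auto simp: A_def)
  have "A * transpose_mat A = 1\<^sub>m n"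
    by (rule eq_matI) (use A in \<open>auto simp: row orth\<close>)
  then have inv: "transpose_mat A * A = 1\<^sub>m n"
    using mat_mult_left_right_inverse[OF A] A by simp
  have complete: "(\<Sum>i=1..n. vec_index (z i) m * vec_index (z i) k) = (if m = k then 1 else 0)"
    if "m < n" "k < n" for m k
  proof -
    have "(\<Sum>i=1..n. vec_index (z i) m * vec_index (z i) k)
        = (\<Sum>i<n. vec_index (z (Suc i)) m * vec_index (z (Suc i)) k)"
      using sum.shift_bounds_Suc_ivl[of "\<lambda>i. vec_index (z i) m * vec_index (z i) k" 0 n]
      by (simp add: atLeastLessThanSuc_atLeastAtMost lessThan_atLeast0)
    also have "\<dots> = (transpose_mat A * A) $$ (m, k)"
      using that A by (simp add: scalar_prod_def A_def lessThan_atLeast0)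
    finally show ?thesis
      using that by (simp add: inv)
  qed
  have "(\<Sum>i=1..n. (norm (\<Sum>m<n. vec_index (z i) m *\<^sub>R y m))\<^sup>2)
      = (\<Sum>i=1..n. \<Sum>m<n. \<Sum>k<n. (vec_index (z i) m * vec_index (z i) k) * inner (y m) (y k))"
    by (simp add: power2_norm_eq_inner inner_sum_left inner_sum_right inner_commute mult_ac)
  also have "\<dots> = (\<Sum>m<n. \<Sum>k<n. \<Sum>i=1..n. (vec_index (z i) m * vec_index (z i) k) * inner (y m) (y k))"
    by (subst sum.swap) (rule sum.cong[OF refl sum.swap])
  also have "\<dots> = (\<Sum>m<n. \<Sum>k<n. (if m = k then 1 else 0) * inner (y m) (y k))"
    by (intro sum.cong refl) (simp only: sum_distrib_right[symmetric] complete lessThan_iff)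
  also have "\<dots> = (\<Sum>m<n. (norm (y m))\<^sup>2)"
    by (simp add: power2_norm_eq_inner if_distrib[of "\<lambda>c. c * _"] cong: if_cong)
  finally show ?thesis .
qed

text \<open>The left-hand side is the bilinear form of the Gram matrix at \<open>x\<close> and
  \<open>y\<close>. Applying the matrix to the eigenvector \<open>y\<close> replaces it by a
  multiple of \<open>y\<close>, the factor \<open>c\<close> undoing the scaling of the
  matrix.\<close>

lemma inner_gram_eigenvector:
  fixes v :: "nat \<Rightarrow> 'a::real_inner"
  assumes carr: "x \<in> carrier_vec n" "y \<in> carrier_vec n"
    and eig: "mat n n (\<lambda>(m, k). inner (v m) (v k) / c) *\<^sub>v y = l \<cdot>\<^sub>v y" and c: "c \<noteq> 0"
  shows "inner (\<Sum>m<n. vec_index x m *\<^sub>R v m) (\<Sum>k<n. vec_index y k *\<^sub>R v k)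
    = c * l * scalar_prod x y"
proof -
  have "(\<Sum>k<n. inner (v m) (v k) * vec_index y k) = c * l * vec_index y m" if m: "m < n" for m
  proof -
    have "vec_index (mat n n (\<lambda>(m, k). inner (v m) (v k) / c) *\<^sub>v y) m
        = (\<Sum>k<n. inner (v m) (v k) * vec_index y k) / c"
      using carr m by (simp add: scalar_prod_def lessThan_atLeast0 sum_divide_distrib)
    then show ?thesis
      using eig carr m c by (simp add: field_simps)
  qed
  then have "(\<Sum>m<n. vec_index x m * (\<Sum>k<n. inner (v m) (v k) * vec_index y k))
      = (\<Sum>m<n. vec_index x m * (c * l * vec_index y m))"
    by simp
  then show ?thesis
    unfolding inner_sum_left inner_scaleR_left using carr
    by (simp add: inner_sum_right scalar_prod_def lessThan_atLeast0 sum_distrib_left mult_ac)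
qed

section \<open>Bounding each snapshot by the whole data collection\<close>

text \<open>Cauchy-Schwarz after enlarging \<open>A\<close> to \<open>{1..n}\<close>. The bound does
  not depend on \<open>A\<close>, so all partial telescoping sums are treated alike.\<close>

lemma norm_sum_power2_le:
  fixes x :: "nat \<Rightarrow> 'a::real_normed_vector"
  assumes "finite A" "A \<subseteq> {1..n}"
  shows "(norm (\<Sum>j\<in>A. x j))\<^sup>2 \<le> real n * (\<Sum>j=1..n. (norm (x j))\<^sup>2)"
proof -
  have "norm (\<Sum>j\<in>A. x j) \<le> (\<Sum>j\<in>A. norm (x j))"
    by (rule norm_sum)
  also have "\<dots> \<le> (\<Sum>j=1..n. norm (x j))"
    using assms by (intro sum_mono2) auto
  finally have "(norm (\<Sum>j\<in>A. x j))\<^sup>2 \<le> (\<Sum>j=1..n. norm (x j))\<^sup>2"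
    by (intro power_mono) auto
  also have "\<dots> \<le> real n * (\<Sum>j=1..n. (norm (x j))\<^sup>2)"
    using sum_squared_le_sum_of_squares[of "\<lambda>j. norm (x j)" "{1..n}"] by (simp add: mult.commute)
  finally show ?thesis .
qed

text \<open>A discrete form of the embedding of H^1(0,T) into C[0,T]. The entry \<open>y k\<close>
  is compared with every \<open>y l\<close>, the increments are controlled by the difference
  quotients, and the result is averaged over \<open>l\<close>.\<close>

lemma discrete_sobolev:
  fixes y :: "nat \<Rightarrow> 'a::real_inner"
  assumes T: "0 < T" and N: "1 \<le> N" and k: "k \<le> N"
    and dq: "\<And>j. j \<in> {1..N} \<Longrightarrow> y (N + j) = (y j - y (j - 1)) /\<^sub>R (T / real N)"
  shows "(norm (y k))\<^sup>2
    \<le> 6 * max 1 (T ^ 2) / real (2 * N + 1) * (\<Sum>m<2 * N + 1. (norm (y m))\<^sup>2)"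
proof -
  define D where "D = (\<Sum>j=1..N. (norm (y (N + j)))\<^sup>2)"
  define E where "E = (\<Sum>l=0..N. (norm (y l))\<^sup>2)"
  have D0: "0 \<le> D" and E0: "0 \<le> E"
    by (auto simp: D_def E_def intro: sum_nonneg)
  have step: "y j - y (j - 1) = (T / real N) *\<^sub>R y (N + j)" if "j \<in> {1..N}" for j
    using dq[OF that] T N by simp
  have tele: "y b - y a = (T / real N) *\<^sub>R (\<Sum>j=a+1..b. y (N + j))" if "a \<le> b" "b \<le> N" for a b
  proof -
    have "y b - y a = (\<Sum>j=a+1..b. y j - y (j - 1))"
      using sum_telescope''[of a b y] that by (simp add: atLeastSucAtMost_greaterThanAtMost)
    also have "\<dots> = (\<Sum>j=a+1..b. (T / real N) *\<^sub>R y (N + j))"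
      using that by (intro sum.cong refl step) auto
    finally show ?thesis
      by (simp add: scaleR_sum_right)
  qed
  \<comment> \<open>The step length squared, (T/N)^2, times the factor \<open>N\<close> from
    Cauchy-Schwarz gives T^2/N.\<close>
  have diff: "(norm (y b - y a))\<^sup>2 \<le> T\<^sup>2 / real N * D" if "a \<le> b" "b \<le> N" for a b
  proof -
    have "(norm (y b - y a))\<^sup>2 = (T / real N)\<^sup>2 * (norm (\<Sum>j=a+1..b. y (N + j)))\<^sup>2"
      unfolding tele[OF that] using T by (simp add: power_mult_distrib power_divide)
    also have "\<dots> \<le> (T / real N)\<^sup>2 * (real N * D)"
      unfolding D_def using that by (intro mult_left_mono norm_sum_power2_le) auto
    also have "\<dots> = T\<^sup>2 / real N * D"
      using N by (simp add: power2_eq_square)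
    finally show ?thesis .
  qed
  have "(norm (y k))\<^sup>2 \<le> 2 * (norm (y l))\<^sup>2 + 2 * (T\<^sup>2 / real N * D)" if "l \<le> N" for l
  proof -
    have "(norm (y k - y l))\<^sup>2 \<le> T\<^sup>2 / real N * D"
      using diff[of l k] diff[of k l] that k by (cases "l \<le> k") (auto simp: norm_minus_commute)
    moreover have "(norm (y k))\<^sup>2 \<le> 2 * (norm (y l))\<^sup>2 + 2 * (norm (y k - y l))\<^sup>2"
    proof -
      have "(norm (y k))\<^sup>2 \<le> (norm (y l) + norm (y k - y l))\<^sup>2"
        using norm_triangle_sub[of "y k" "y l"] by (intro power_mono) auto
      also have "\<dots> \<le> 2 * (norm (y l))\<^sup>2 + 2 * (norm (y k - y l))\<^sup>2"
        using sum_squares_bound[of "norm (y l)" "norm (y k - y l)"] by (simp add: power2_sum)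
      finally show ?thesis .
    qed
    ultimately show ?thesis
      by linarith
  qed
  \<comment> \<open>Averaging over all \<open>N + 1\<close> snapshots turns the single term at
    \<open>l\<close> into \<open>E / (N + 1)\<close>, which is then weakened to \<open>E / N\<close>
    so that both terms share the factor \<open>2 / N\<close>.\<close>
  then have "(\<Sum>l=0..N. (norm (y k))\<^sup>2) \<le> (\<Sum>l=0..N. 2 * (norm (y l))\<^sup>2 + 2 * (T\<^sup>2 / real N * D))"
    by (intro sum_mono) auto
  then have "(real N + 1) * (norm (y k))\<^sup>2 \<le> 2 * E + (real N + 1) * (2 * (T\<^sup>2 / real N * D))"
    by (simp add: sum.distrib E_def sum_distrib_left algebra_simps)
  then have "(norm (y k))\<^sup>2 \<le> 2 * E / (real N + 1) + 2 * (T\<^sup>2 / real N * D)"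
    by (simp add: field_simps)
  also have "\<dots> \<le> 2 * E / real N + 2 * (T\<^sup>2 / real N * D)"
    using N E0 by (intro add_right_mono divide_left_mono) auto
  also have "\<dots> = 2 / real N * (1 * E + T\<^sup>2 * D)"
    by (simp add: algebra_simps)
  also have "\<dots> \<le> 2 / real N * (max 1 (T\<^sup>2) * E + max 1 (T\<^sup>2) * D)"
    using D0 E0 by (intro mult_left_mono add_mono mult_right_mono) auto
  also have "\<dots> = 2 / real N * (max 1 (T\<^sup>2) * (E + D))"
    by (simp add: algebra_simps)
  \<comment> \<open>The constant 6 arises here: 2 (2 N + 1) \<le> 6 N because N \<ge> 1.\<close>
  also have "\<dots> \<le> 6 / real (2 * N + 1) * (max 1 (T\<^sup>2) * (E + D))"
    using N D0 E0 by (intro mult_right_mono mult_nonneg_nonneg) (auto simp: field_simps)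
  also have "E + D = (\<Sum>m<2 * N + 1. (norm (y m))\<^sup>2)"
  proof -
    have "D = (\<Sum>m=N+1..2*N. (norm (y m))\<^sup>2)"
      using sum.shift_bounds_cl_nat_ivl[of "\<lambda>m. (norm (y m))\<^sup>2" 1 N N]
      by (simp add: D_def add.commute mult_2)
    moreover have "{..<2*N+1} = {0..N} \<union> {N+1..2*N}"
      by auto
    ultimately show ?thesis
      unfolding E_def by (simp add: sum.union_disjoint)
  qed
  finally show ?thesis
    by simp
qed

section \<open>Counting the positive eigenvalues\<close>

text \<open>For a nonincreasing sequence the positive entries occupy an initial segment of the
  indices, so their number is also the last index of that segment.\<close>

lemma num_positive_iff:
  assumes "\<And>i j. 1 \<le> i \<Longrightarrow> i \<le> j \<Longrightarrow> j \<le> 2 * N + 1 \<Longrightarrow> lam j \<le> lam i"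
    and i: "i \<in> {1..2 * N + 1}"
  shows "0 < lam i \<longleftrightarrow> i \<le> num_positive N lam"
proof
  assume "0 < lam i"
  then have "{1..i} \<subseteq> {j \<in> {1..2 * N + 1}. 0 < lam j}"
    using assms(1)[of _ i] i by force
  from card_mono[OF _ this] show "i \<le> num_positive N lam"
    by (simp add: num_positive_def)
next
  assume le: "i \<le> num_positive N lam"
  show "0 < lam i"
  proof (rule ccontr)
    assume "\<not> 0 < lam i"
    then have "lam j \<le> 0" if "i \<le> j" "j \<le> 2 * N + 1" for j
      using assms(1)[of i j] i that by auto
    then have "j < i" if "j \<le> 2 * N + 1" "0 < lam j" for j
      using that by (meson not_less)
    then have "{j \<in> {1..2 * N + 1}. 0 < lam j} \<subseteq> {1..<i}"
      by auto
    from card_mono[OF _ this] le i show False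
      by (auto simp: num_positive_def)
  qed
qed

lemma num_positive_le: "num_positive N lam \<le> 2 * N + 1"
proof -
  have "card {i \<in> {1..2 * N + 1}. 0 < lam i} \<le> card {1..2 * N + 1}"
    by (intro card_mono) auto
  then show ?thesis
    by (simp add: num_positive_def)
qed

section \<open>POD modes and the error identity for linear images\<close>

locale pod_system =
  fixes u :: "real \<Rightarrow> 'h::real_inner" and T :: real and N :: nat
    and lam :: "nat \<Rightarrow> real" and z :: "nat \<Rightarrow> real vec"
  assumes eigensystem: "ordered_eigensystem (pod_matrix u T N) lam z"
begin

abbreviation "s \<equiv> num_positive N lam"
abbreviation "\<phi> \<equiv> pod_mode u T N lam z"
abbreviation "v \<equiv> dq_data u T N"

text \<open>The POD mode before normalisation. It makes sense for every index, also where the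
  eigenvalue is not positive and the normalising factor of \<open>pod_mode\<close> is
  meaningless.\<close>

definition combination :: "nat \<Rightarrow> 'h" where
  "combination i = (\<Sum>m<2 * N + 1. vec_index (z i) m *\<^sub>R v m)"

lemma z_carrier: "i \<in> {1..2 * N + 1} \<Longrightarrow> z i \<in> carrier_vec (2 * N + 1)"
  using eigensystem unfolding ordered_eigensystem_def eigenvector_def by (simp add: pod_matrix_def)

lemma z_orthonormal:
  "i \<in> {1..2 * N + 1} \<Longrightarrow> j \<in> {1..2 * N + 1} \<Longrightarrow>
    scalar_prod (z i) (z j) = (if i = j then 1 else 0)"
  using eigensystem unfolding ordered_eigensystem_def by (simp add: pod_matrix_def)

lemma z_eigen:
  "i \<in> {1..2 * N + 1} \<Longrightarrow> pod_matrix u T N *\<^sub>v z i = lam i \<cdot>\<^sub>v z i"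
  using eigensystem unfolding ordered_eigensystem_def eigenvector_def by (simp add: pod_matrix_def)

lemma lam_pos_iff: "i \<in> {1..2 * N + 1} \<Longrightarrow> 0 < lam i \<longleftrightarrow> i \<le> s"
  using eigensystem unfolding ordered_eigensystem_def
  by (intro num_positive_iff) (simp_all add: pod_matrix_def)

lemma lam_pos: "i \<in> {1..s} \<Longrightarrow> 0 < lam i"
  using lam_pos_iff[of i] num_positive_le[of N lam] by auto

lemma inner_combination:
  assumes "i \<in> {1..2 * N + 1}" "j \<in> {1..2 * N + 1}"
  shows "inner (combination i) (combination j) =
    (if i = j then real (2 * N + 1) * lam i else 0)"
proof -
  have "inner (combination i) (combination j) =
      real (2 * N + 1) * lam j * scalar_prod (z i) (z j)"
    unfolding combination_def using assms z_eigen[of j]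
    by (intro inner_gram_eigenvector z_carrier) (auto simp: pod_matrix_def)
  then show ?thesis
    using z_orthonormal[OF assms] by simp
qed

text \<open>The squared norm is a positive multiple of an eigenvalue that is not positive. Hence the
  Parseval sum over all \<open>2 * N + 1\<close> indices stops at \<open>s\<close>.\<close>

lemma combination_eq_0:
  assumes "i \<in> {1..2 * N + 1}" "s < i"
  shows "combination i = 0"
proof -
  have "(norm (combination i))\<^sup>2 = real (2 * N + 1) * lam i"
    using inner_combination[of i i] assms by (simp add: power2_norm_eq_inner)
  moreover have "lam i \<le> 0"
    using lam_pos_iff[of i] assms by auto
  ultimately have "(norm (combination i))\<^sup>2 \<le> 0"
    by (simp add: mult_nonneg_nonpos)
  then show ?thesis
    by simp
qed

lemma pod_mode_eq:
  "\<phi> i = (1 / (sqrt (lam i) * sqrt (real (2 * N + 1)))) *\<^sub>R combination i"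
  by (simp add: pod_mode_def combination_def atLeast0AtMost lessThan_Suc_atMost del: sum.lessThan_Suc)

lemma inner_pod_mode:
  assumes "i \<in> {1..s}" "j \<in> {1..s}"
  shows "inner (\<phi> i) (\<phi> j) = (if i = j then 1 else 0)"
proof -
  define c where "c = real (2 * N + 1)"
  have c: "0 < c"
    by (simp add: c_def)
  have "i \<in> {1..2 * N + 1}" "j \<in> {1..2 * N + 1}"
    using assms num_positive_le[of N lam] by auto
  then have "inner (\<phi> i) (\<phi> j) = (if i = j then c * lam i / (sqrt (lam i) * sqrt c)\<^sup>2 else 0)"
    unfolding pod_mode_eq by (simp add: inner_combination power2_eq_square c_def)
  then show ?thesis
    using lam_pos[OF assms(1)] c by (auto simp: power_mult_distrib)
qed

lemma pod_proj_pod_mode: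
  assumes "i \<in> {1..s}" "r \<le> s"
  shows "pod_proj \<phi> r (\<phi> i) = (if i \<le> r then \<phi> i else 0)"
proof -
  have "pod_proj \<phi> r (\<phi> i) = (\<Sum>j=1..r. if i = j then \<phi> j else 0)"
    unfolding pod_proj_def using assms by (intro sum.cong refl) (auto simp: inner_pod_mode)
  then show ?thesis
    using assms by simp
qed

text \<open>Parseval is applied to the vectors \<open>L (v m)\<close>, and \<open>L\<close> is moved
  through the finite sums, which needs linearity alone; this matters because the passage to
  \<open>W\<close> may be unbounded in the norm of \<open>H\<close>. Terms with
  \<open>i \<le> r\<close> vanish by \<open>vanish\<close>, those with \<open>i > s\<close> by
  \<open>combination_eq_0\<close>.\<close>

lemma sum_norm_linear_image:
  fixes L :: "'h \<Rightarrow> 'w::real_inner"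
  assumes L: "linear L" and vanish: "\<And>i. i \<in> {1..r} \<Longrightarrow> L (\<phi> i) = 0" and r: "r \<le> s"
  shows "(\<Sum>m<2 * N + 1. (norm (L (v m)))\<^sup>2)
    = real (2 * N + 1) * (\<Sum>i=r+1..s. lam i * (norm (L (\<phi> i)))\<^sup>2)"
proof -
  have image: "(norm (L (combination i)))\<^sup>2 = real (2 * N + 1) * (lam i * (norm (L (\<phi> i)))\<^sup>2)"
    if "i \<in> {1..s}" for i
  proof -
    have "L (\<phi> i) = (1 / (sqrt (lam i) * sqrt (real (2 * N + 1)))) *\<^sub>R L (combination i)"
      unfolding pod_mode_eq by (simp add: linear_scale[OF L])
    then have "(norm (L (\<phi> i)))\<^sup>2 = (norm (L (combination i)))\<^sup>2 / (lam i * real (2 * N + 1))"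
      using lam_pos[OF that] by (simp add: power_mult_distrib power_divide)
    then show ?thesis
      using lam_pos[OF that] by simp
  qed
  have "(\<Sum>m<2 * N + 1. (norm (L (v m)))\<^sup>2)
      = (\<Sum>i=1..2 * N + 1. (norm (\<Sum>m<2 * N + 1. vec_index (z i) m *\<^sub>R L (v m)))\<^sup>2)"
    by (rule orthonormal_parseval[symmetric]) (simp_all only: z_carrier z_orthonormal)
  also have "\<dots> = (\<Sum>i=1..2 * N + 1. (norm (L (combination i)))\<^sup>2)"
    unfolding combination_def by (simp only: linear_sum[OF L] linear_scale[OF L])
  also have "\<dots> = (\<Sum>i=r+1..s. (norm (L (combination i)))\<^sup>2)"
  proof (rule sum.mono_neutral_right)
    show "\<forall>i\<in>{1..2 * N + 1} - {r+1..s}. (norm (L (combination i)))\<^sup>2 = 0"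
    proof
      fix i assume i: "i \<in> {1..2 * N + 1} - {r+1..s}"
      show "(norm (L (combination i)))\<^sup>2 = 0"
      proof (cases "i \<le> r")
        case True
        then show ?thesis
          using i r image[of i] vanish[of i] by simp
      next
        case False
        then show ?thesis
          using i combination_eq_0[of i] by (simp add: linear_0[OF L])
      qed
    qed
  qed (use num_positive_le[of N lam] in auto)
  also have "\<dots> = real (2 * N + 1) * (\<Sum>i=r+1..s. lam i * (norm (L (\<phi> i)))\<^sup>2)"
    unfolding sum_distrib_left by (intro sum.cong refl image) auto
  finally show ?thesis .
qed

lemma max_snapshot_linear_image:
  fixes L :: "'h \<Rightarrow> 'w::real_inner"
  assumes L: "linear L" and "\<And>i. i \<in> {1..r} \<Longrightarrow> L (\<phi> i) = 0" and "r \<le> s"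
    and T: "0 < T" and N: "1 \<le> N"
  shows "(MAX k\<in>{0..N}. (norm (L (snapshot u T N k)))\<^sup>2)
    \<le> 6 * max 1 (T ^ 2) * (\<Sum>i=r+1..s. lam i * (norm (L (\<phi> i)))\<^sup>2)"
proof -
  \<comment> \<open>Linear maps preserve difference quotients. Since 1 \<le> j \<le> N, the indices
    \<open>j\<close> and \<open>j - 1\<close> denote snapshots and \<open>N + j\<close> a
    quotient.\<close>
  have "L (v (N + j)) = (L (v j) - L (v (j - 1))) /\<^sub>R (T / real N)" if "j \<in> {1..N}" for j
    using that by (auto simp: dq_data_def diff_quot_def linear_scale[OF L] linear_diff[OF L])
  note sobolev = discrete_sobolev[where y = "\<lambda>m. L (v m)", OF T N _ this]
  have "(norm (L (v k)))\<^sup>2 \<le> 6 * max 1 (T ^ 2) *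
      (\<Sum>i=r+1..s. lam i * (norm (L (\<phi> i)))\<^sup>2)" if "k \<le> N" for k
  proof -
    have "(norm (L (v k)))\<^sup>2 \<le> 6 * max 1 (T ^ 2) / real (2 * N + 1) *
        (real (2 * N + 1) * (\<Sum>i=r+1..s. lam i * (norm (L (\<phi> i)))\<^sup>2))"
      using sobolev[OF that] sum_norm_linear_image[OF assms(1-3)] by simp
    then show ?thesis
      by simp
  qed
  then show ?thesis
    by (auto simp: dq_data_def)
qed

end

section \<open>The three error estimates\<close>

theorem theorem3p7:
  fixes u :: "real \<Rightarrow> 'h::{real_inner, complete_space}"
    and jH :: "'h \<Rightarrow> 'v::real_vector"
    and jW :: "'w::{real_inner, complete_space} \<Rightarrow> 'v"
    and R :: "'w \<Rightarrow> 'w"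
    and T :: real and N r s :: nat
    and lam :: "nat \<Rightarrow> real" and z :: "nat \<Rightarrow> real vec"
    and \<phi> :: "nat \<Rightarrow> 'h" and toW :: "'h \<Rightarrow> 'w" and C :: real
  defines "s \<equiv> num_positive N lam"
    and "\<phi> \<equiv> pod_mode u T N lam z"
    and "toW \<equiv> as_elem jH jW"
    and "C \<equiv> 6 * max 1 (T ^ 2)"
  assumes "0 < T" and "1 \<le> N"
    and "continuous_on {0..T} u"
    and "ordered_eigensystem (pod_matrix u T N) lam z"
    and "1 \<le> r" and "r \<le> s"
    and "linear jH" and "inj jH" and "linear jW" and "inj jW"
    and "\<forall>n\<le>2 * N. jH (dq_data u T N n) \<in> range jW"
    and "bounded_projection_onto R (toW ` pod_space \<phi> r)"
  shows "(MAX k\<in>{0..N}. (norm (snapshot u T N k - pod_proj \<phi> r (snapshot u T N k)))\<^sup>2)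
           \<le> C * (\<Sum>i=r+1..s. lam i)
       \<and> (MAX k\<in>{0..N}. (norm (toW (snapshot u T N k - pod_proj \<phi> r (snapshot u T N k))))\<^sup>2)
           \<le> C * (\<Sum>i=r+1..s. lam i * (norm (toW (\<phi> i)))\<^sup>2)
       \<and> (MAX k\<in>{0..N}. (norm (toW (snapshot u T N k) - R (toW (snapshot u T N k))))\<^sup>2)
           \<le> C * (\<Sum>i=r+1..s. lam i * (norm (toW (\<phi> i) - R (toW (\<phi> i))))\<^sup>2)"
proof -
  interpret pod_system u T N lam z
    by unfold_locales (fact assms)
  note [simp] = \<phi>_def s_def
  have pos: "0 < T" "1 \<le> N" and r: "r \<le> num_positive N lam"
    using assms by simp_all
  note bound = max_snapshot_linear_image[OF _ _ r pos]
  \<comment> \<open>\<open>toW\<close> is linear only on \<open>S\<close> below; \<open>p \<circ> jH\<close> extends it to a linear map on the whole type.\<close>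
  obtain p where p: "linear p" "p \<circ> jW = id"
    using linear_injective_left_inverse[OF \<open>linear jW\<close> \<open>inj jW\<close>] by blast
  define S where "S = {x. jH x \<in> range jW}"
  have S: "subspace S"
    using linear_subspace_vimage[OF \<open>linear jH\<close> linear_subspace_image[OF \<open>linear jW\<close> subspace_UNIV]]
    by (simp add: S_def vimage_def)
  have toW: "toW x = p (jH x)" if "x \<in> S" for x
    using that p(2) \<open>inj jW\<close> by (auto simp: S_def toW_def as_elem_def pointfree_idE)
  have data_S: "dq_data u T N n \<in> S" if "n \<le> 2 * N" for n
    using assms that by (simp add: S_def)
  have mode_S: "\<phi> i \<in> S" for i
    unfolding \<phi>_def pod_mode_def using data_S
    by (intro subspace_scale[OF S] subspace_sum[OF S]) auto
  have snap_S: "snapshot u T N k \<in> S" if "k \<le> N" for k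
    using data_S[of k] that by (simp add: dq_data_def)
  have proj_S: "pod_proj \<phi> r x \<in> S" for x
    unfolding pod_proj_def by (intro subspace_sum[OF S] subspace_scale[OF S] mode_S)

  have lin_proj: "linear (\<lambda>x. x - pod_proj \<phi> r x)"
    unfolding pod_proj_def
    by (rule linearI) (simp_all add: inner_add_left scaleR_left_distrib sum.distrib
        scaleR_sum_right scaleR_diff_right)
  have proj_low: "\<phi> i - pod_proj \<phi> r (\<phi> i) = 0" if "i \<in> {1..r}" for i
    using that r by (simp add: pod_proj_pod_mode)
  have proj_high: "\<phi> i - pod_proj \<phi> r (\<phi> i) = \<phi> i" if "i \<in> {r+1..s}" for i
    using that r by (simp add: pod_proj_pod_mode)
  have lin_p: "linear (\<lambda>x. p (jH x))"
    using linear_compose[OF \<open>linear jH\<close> p(1)] by (simp add: o_def)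

  \<comment> \<open>First estimate: I - P_r kills the first \<open>r\<close> modes and fixes the
    later ones, which have norm 1.\<close>
  have "(MAX k\<in>{0..N}. (norm (snapshot u T N k - pod_proj \<phi> r (snapshot u T N k)))\<^sup>2)
      \<le> C * (\<Sum>i=r+1..s. lam i * (norm (\<phi> i - pod_proj \<phi> r (\<phi> i)))\<^sup>2)"
    using bound[OF lin_proj] proj_low by (simp add: C_def)
  also have "(\<Sum>i=r+1..s. lam i * (norm (\<phi> i - pod_proj \<phi> r (\<phi> i)))\<^sup>2) = (\<Sum>i=r+1..s. lam i)"
  proof (intro sum.cong refl)
    fix i assume i: "i \<in> {r+1..s}"
    then have "(norm (\<phi> i))\<^sup>2 = 1"
      using inner_pod_mode[of i i] by (simp add: power2_norm_eq_inner)
    then show "lam i * (norm (\<phi> i - pod_proj \<phi> r (\<phi> i)))\<^sup>2 = lam i"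
      unfolding proj_high[OF i] by simp
  qed
  finally have 1: "(MAX k\<in>{0..N}. (norm (snapshot u T N k - pod_proj \<phi> r (snapshot u T N k)))\<^sup>2)
      \<le> C * (\<Sum>i=r+1..s. lam i)" .

  \<comment> \<open>Second estimate: snapshots and their projections lie in \<open>S\<close>, so
    \<open>toW\<close> may be exchanged for the linear map \<open>p \<circ> jH\<close> before the
    bound is applied and back again afterwards.\<close>
  have "(MAX k\<in>{0..N}. (norm (toW (snapshot u T N k - pod_proj \<phi> r (snapshot u T N k))))\<^sup>2)
      = (MAX k\<in>{0..N}. (norm (p (jH (snapshot u T N k - pod_proj \<phi> r (snapshot u T N k)))))\<^sup>2)"
    by (intro arg_cong[where f = Max] image_cong refl)
      (simp add: toW subspace_diff[OF S] snap_S proj_S del: \<phi>_def)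
  also have "\<dots> \<le> C * (\<Sum>i=r+1..s. lam i * (norm (p (jH (\<phi> i - pod_proj \<phi> r (\<phi> i)))))\<^sup>2)"
    using bound[OF linear_compose[OF lin_proj lin_p]] proj_low linear_0[OF lin_p]
    by (simp add: C_def o_def)
  also have "\<dots> = C * (\<Sum>i=r+1..s. lam i * (norm (toW (\<phi> i)))\<^sup>2)"
    by (intro arg_cong[where f = "(*) C"] sum.cong refl) (simp only: proj_high toW mode_S)
  finally have 2: "(MAX k\<in>{0..N}. (norm (toW (snapshot u T N k - pod_proj \<phi> r (snapshot u T N k))))\<^sup>2)
      \<le> C * (\<Sum>i=r+1..s. lam i * (norm (toW (\<phi> i)))\<^sup>2)" .

  have R: "linear R" "R \<circ> R = R" "range R = toW ` pod_space \<phi> r"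
    using assms by (auto simp: bounded_projection_onto_def bounded_linear.linear)
  have lin_R: "linear (\<lambda>x. p (jH x) - R (p (jH x)))"
    using linear_compose_sub[OF lin_p linear_compose[OF lin_p R(1)]] by (simp add: o_def)
  \<comment> \<open>Third estimate: the first \<open>r\<close> modes lie in the range of
    \<open>R\<close>, and an idempotent map fixes its range.\<close>
  have R_low: "p (jH (\<phi> i)) - R (p (jH (\<phi> i))) = 0" if "i \<in> {1..r}" for i
  proof -
    have "\<phi> i \<in> pod_space \<phi> r"
      unfolding pod_space_def using that by (intro span_base) auto
    then have "toW (\<phi> i) \<in> range R"
      using R(3) by blast
    then obtain w where "toW (\<phi> i) = R w"
      by blast
    then show ?thesis
      using toW[OF mode_S] R(2) by (metis comp_apply eq_iff_diff_eq_0)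
  qed
  have "(MAX k\<in>{0..N}. (norm (toW (snapshot u T N k) - R (toW (snapshot u T N k))))\<^sup>2)
      = (MAX k\<in>{0..N}. (norm (p (jH (snapshot u T N k)) - R (p (jH (snapshot u T N k)))))\<^sup>2)"
    by (intro arg_cong[where f = Max] image_cong refl) (simp add: toW snap_S)
  also have "\<dots> \<le> C * (\<Sum>i=r+1..s. lam i * (norm (p (jH (\<phi> i)) - R (p (jH (\<phi> i)))))\<^sup>2)"
    using bound[OF lin_R] R_low by (simp add: C_def)
  also have "\<dots> = C * (\<Sum>i=r+1..s. lam i * (norm (toW (\<phi> i) - R (toW (\<phi> i))))\<^sup>2)"
    by (simp only: toW mode_S)
  finally show ?thesis
    using 1 2 by blast
qed

end
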